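(* Assume (A), i.e. (A1) and (A2) hold for every level $l\in\{0,\dots,L\}$. Then for any $n,L\geq 1$ there exist constants $B_0(n),\dots,B_L(n)<+\infty$ (not depending on $N_0,\dots,N_L$) such that for any $N_0,\dots,N_L\geq 1$, $$ \mathbb{E}\Big[\Big(\widehat{p}^{L,N_{0:L}}(n)-p^{L}(n)\Big)^2\Big] \leq \sum_{l=0}^L \frac{B_l(n)}{N_l}. $$
   Context: Notation: $\mathcal U=\mathbb R^d$, $\mathcal V=\mathcal U\times\mathcal U$, $v=(u_1,u_2)$. For a probability $\mu$ on $\mathcal V$, $\mu_j$ is its $j$-th marginal, and for $\varphi:\mathcal U\to\mathbb R$, $\varphi_j(v)=\varphi(u_j)$, $\mu(\varphi_j)=\int\varphi(u_j)\mu(dv)$. Coupled particle system (one level). Given: potentials $G_p:\mathcal U\to(0,\infty)$, $p\ge0$; a probability $\eta_0$ on $\mathcal V$; Markov kernels $M_n$ from $\mathcal V$ to $\mathcal V$, $n\ge1$, for which there are Markov kernels $M_{n,j}$ on $\mathcal U$ ($j=1,2$) with $\int\varphi(u'_j)M_n(v,dv')=\int\varphi(u_j')M_{n,j}(u_j,du_j')$ for all bounded measurable $\varphi$. The marginal Feynman–Kac quantities are $\gamma_{n,j}(\varphi)=\int \varphi(u_n)\prod_{p=0}^{n-1}G_p(u_p)\,\eta_{0,j}(du_0)\prod_{p=1}^nM_{p,j}(u_{p-1},du_p)$ and $\eta_{n,j}=\gamma_{n,j}/\gamma_{n,j}(1)$. For $\mu$ a probability on $\mathcal V$ set $G_{n,j,\mu}(u)=G_n(u)/\mu_j(G_n)$,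 $\bar G_{n,\mu}(v)=G_{n,1,\mu}(u_1)\wedge G_{n,2,\mu}(u_2)$ and $$\bar\Phi_n(\mu)(dv')=\mu\big(\bar G_{n-1,\mu}M_n(\cdot,dv')\big)+\big(1-\mu(\bar G_{n-1,\mu})\big)\int\!\!\int \frac{(G_{n-1,1,\mu}-\bar G_{n-1,\mu})(v)}{\mu(G_{n-1,1,\mu}-\bar G_{n-1,\mu})}\frac{(G_{n-1,2,\mu}-\bar G_{n-1,\mu})(\tilde v)}{\mu(G_{n-1,2,\mu}-\bar G_{n-1,\mu})}M_n((u_1,\tilde u_2),dv')\mu(dv)\mu(d\tilde v),$$ (second term absent when $\mu(\bar G_{n-1,\mu})=1$; here $G_{n-1,1,\mu}$ is evaluated at $u_1$, $G_{n-1,2,\mu}$ at $\tilde u_2$). With $N$ particles: $v_0^i\stackrel{iid}{\sim}\eta_0$, and for $p\ge1$, conditionally independently $v_p^i\sim\bar\Phi_p(\bar\eta^N_{p-1})$, $i=1,\dots,N$, where $\bar\eta^N_p=\frac1N\sum_i\delta_{v_p^i}$ with $j$-th marginal $\eta^N_{p,j}$. The estimate is $\gamma^N_{n,j}(1)=\prod_{p=0}^{n-1}\eta^N_{p,j}(G_p)$. Multilevel estimator: for each level $l=0,\dots,L$ one runs, independently across levels, such a coupled system with $N_l$ particles and level-specific $(\eta_0^l,M_n^l)$ (fine marginal $j=1$ corresponds to Euler step $2^{-l}$, coarse $j=2$ to step $2^{-(l-1)}$; at level $0$ only the $j=1$ component is used), giving $\gamma^{l,N_l}_{n,j}(1)$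 and targets $\gamma^l_{n,j}(1)$. Set $\widehat p^{L,N_{0:L}}(n)=\sum_{l=0}^L\{\gamma^{l,N_l}_{n,1}(1)-\gamma^{l,N_l}_{n,2}(1)\}$ and $p^L(n)=\sum_{l=0}^L\{\gamma^{l}_{n,1}(1)-\gamma^{l}_{n,2}(1)\}$, with the level-0 second terms equal to $0$. (A1): there exist $c>1$, $C>0$ such that for all $n\ge0$, $x,x'\in\mathcal U$: $c^{-1}<G_n(x)<c$ and $|G_n(x)-G_n(x')|\le C|x-x'|$. (A2): for each $n$ there is $C_n>0$ such that for all $u,u'\in\mathcal U$, $j\in\{1,2\}$ and bounded Lipschitz $\varphi$, $|M_{n,j}(\varphi)(u)-M_{n,j}(\varphi)(u')|\le C_n\sup|\varphi|\,|u-u'|$. $\mathbb E$ denotes expectation w.r.t. the law of all particle systems. *)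

theory Defs
  imports "HOL-Probability.Probability"
begin

text \<open>Coordinate j of v = (u1,u2) in V = U x U (j = 1 fine, j = 2 coarse).\<close>
definition comp :: "nat \<Rightarrow> 'u \<times> 'u \<Rightarrow> 'u" where
  "comp j v = (if j = 1 then fst v else snd v)"

definition Gnorm :: "('u \<Rightarrow> real) \<Rightarrow> ('u \<times> 'u) measure \<Rightarrow> nat \<Rightarrow> 'u \<Rightarrow> real" where
  "Gnorm G mu j u = G u / (\<integral>v. G (comp j v) \<partial>mu)"

definition Gbar :: "('u \<Rightarrow> real) \<Rightarrow> ('u \<times> 'u) measure \<Rightarrow> 'u \<times> 'u \<Rightarrow> real" where
  "Gbar G mu v = min (Gnorm G mu 1 (fst v)) (Gnorm G mu 2 (snd v))"

text \<open>The coupled selection-mutation operator bar Phi_n(mu), with G = G_{n-1} and K = M_n.\<close>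
definition Phibar :: "('u::topological_space \<Rightarrow> real) \<Rightarrow> ('u \<times> 'u \<Rightarrow> ('u \<times> 'u) measure)
     \<Rightarrow> ('u \<times> 'u) measure \<Rightarrow> ('u \<times> 'u) measure" where
  "Phibar G K mu = measure_of UNIV (sets borel) (\<lambda>A.
     ennreal (\<integral>v. Gbar G mu v * measure (K v) A \<partial>mu) +
     (if (\<integral>v. Gbar G mu v \<partial>mu) = 1 then 0 else
      ennreal ((1 - (\<integral>v. Gbar G mu v \<partial>mu)) *
        (\<integral>v. (\<integral>w.
            ((Gnorm G mu 1 (fst v) - Gbar G mu v) /
               (\<integral>x. Gnorm G mu 1 (fst x) - Gbar G mu x \<partial>mu)) *
            ((Gnorm G mu 2 (snd w) - Gbar G mu w) /
               (\<integral>x. Gnorm G mu 2 (snd x) - Gbar G mu x \<partial>mu)) *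
            measure (K (fst v, snd w)) A \<partial>mu) \<partial>mu))))"

definition emp :: "nat \<Rightarrow> (nat \<Rightarrow> 'v) \<Rightarrow> 'v measure" where
  "emp N x = measure_pmf (pmf_of_multiset (mset (map x [0..<N])))"

text \<open>Law of the trajectory (configurations at times 0..p) of the coupled N-particle
  system at one level with initial law eta0 and kernels M (M q used at time q >= 1).
  A trajectory omega maps time q <= p to the configuration omega q, which maps
  particle index i < N to v_q^i.\<close>
primrec traj :: "('u::topological_space \<times> 'u) measure \<Rightarrow> (nat \<Rightarrow> 'u \<times> 'u \<Rightarrow> ('u \<times> 'u) measure)
     \<Rightarrow> (nat \<Rightarrow> 'u \<Rightarrow> real) \<Rightarrow> nat \<Rightarrow> nat \<Rightarrow> (nat \<Rightarrow> nat \<Rightarrow> 'u \<times> 'u) measure" where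
  "traj eta0 M G N 0 =
     distr (PiM {..<N} (\<lambda>_. eta0)) (PiM {..0} (\<lambda>_. PiM {..<N} (\<lambda>_. borel)))
       (\<lambda>x. \<lambda>q\<in>{..0}. x)"
| "traj eta0 M G N (Suc p) =
     traj eta0 M G N p \<bind> (\<lambda>\<omega>.
       distr (PiM {..<N} (\<lambda>_. Phibar (G p) (M (Suc p)) (emp N (\<omega> p))))
             (PiM {..Suc p} (\<lambda>_. PiM {..<N} (\<lambda>_. borel)))
             (\<lambda>x. fun_upd \<omega> (Suc p) x))"

definition gammaN :: "(nat \<Rightarrow> 'u \<Rightarrow> real) \<Rightarrow> nat \<Rightarrow> nat \<Rightarrow> nat \<Rightarrow> (nat \<Rightarrow> nat \<Rightarrow> 'u \<times> 'u) \<Rightarrow> real" where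
  "gammaN G N n j \<omega> = (\<Prod>p<n. \<integral>v. G p (comp j v) \<partial>(emp N (\<omega> p)))"

text \<open>Marginal Feynman-Kac measure gamma_{n,j}(phi), as the iterated integral
  eta_{0,j}(G_0 M_{1,j}(G_1 M_{2,j}( ... G_{n-1} M_{n,j}(phi)))).
  Mj q j is the marginal kernel M_{q,j}.\<close>
primrec gammaFK :: "('u \<times> 'u) measure \<Rightarrow> (nat \<Rightarrow> nat \<Rightarrow> 'u \<Rightarrow> 'u measure) \<Rightarrow> (nat \<Rightarrow> 'u \<Rightarrow> real)
     \<Rightarrow> nat \<Rightarrow> nat \<Rightarrow> ('u \<Rightarrow> real) \<Rightarrow> real" where
  "gammaFK eta0 Mj G j 0 \<phi> = (\<integral>v. \<phi> (comp j v) \<partial>eta0)"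
| "gammaFK eta0 Mj G j (Suc n) \<phi> =
     gammaFK eta0 Mj G j n (\<lambda>u. G n u * (\<integral>u'. \<phi> u' \<partial>(Mj (Suc n) j u)))"

end

theory Submission
  imports Defs
begin

text \<open>
  On an empirical measure the coupled selection step is a finite mixture of the kernels, whose weights
  form a coupling of the two normalised potentials. Hence either component of a new particle, given the
  past, has mean \<open>\<eta>\<^sup>N(G M\<phi>) / \<eta>\<^sup>N(G)\<close>, so the unnormalised estimate \<open>\<gamma>\<^sup>N(\<phi>)\<close> at time \<open>p + 1\<close> has conditional
  mean \<open>\<gamma>\<^sup>N(G M\<phi>)\<close> at time \<open>p\<close>, and its conditional variance is \<open>O(1/N)\<close> because the particles are
  conditionally independent and the potentials bounded. Induction on \<open>p\<close> bounds the mean square error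
  of every marginal estimate by \<open>O(1/N)\<close>. The constants may depend on the number of levels, so the
  levels are combined by the Cauchy--Schwarz inequality.
\<close>


section \<open>Empirical averages and the weights of the selection coupling\<close>

lemma measurable_comp: "comp j \<in> (borel :: ('u::topological_space \<times> 'u) measure) \<rightarrow>\<^sub>M borel"
  by (cases "j = 1") (auto simp: comp_def[abs_def] intro!: borel_measurable_continuous_onI continuous_intros)

lemma integral_emp:
  fixes f :: "'v \<Rightarrow> real"
  assumes "N \<ge> 1"
  shows "(\<integral>v. f v \<partial>emp N x) = (\<Sum>i<N. f (x i)) / N"
proof -
  have ne: "{..<N} \<noteq> {}"
    using assms by (auto simp: lessThan_empty_iff)
  \<comment> \<open>The uniform law on the multiset of positions is the image of the uniform law on
    the indices, so coinciding particles keep their multiplicity.\<close>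
  have "emp N x = measure_pmf (map_pmf x (pmf_of_set {..<N}))"
    unfolding emp_def map_pmf_of_set[OF finite_lessThan ne]
    by (simp add: atLeast0LessThan)
  then show ?thesis
    using ne by (simp add: integral_pmf_of_set)
qed

text \<open>
  With \<open>a\<close>, \<open>b\<close> the normalised potentials of the two components, this is the mass that the selection
  step puts on the pair formed by the first component of particle \<open>i\<close> and the second component of
  particle \<open>k\<close>. Both terms of the selection operator fit this form, since the diagonal pairs are the
  particles themselves.
\<close>

definition coupling_weight :: "nat \<Rightarrow> (nat \<Rightarrow> real) \<Rightarrow> (nat \<Rightarrow> real) \<Rightarrow> nat \<Rightarrow> nat \<Rightarrow> real" where
  "coupling_weight N a b i k =
     (if i = k then min (a i) (b i) / N else 0) +
     (if (\<Sum>i<N. min (a i) (b i)) / N = 1 then 0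
      else (a i - min (a i) (b i)) * (b k - min (a k) (b k)) /
           ((real N)\<^sup>2 * (1 - (\<Sum>i<N. min (a i) (b i)) / N)))"

text \<open>Exchanging the components transposes the weights, so the second marginal can be read off
  \<open>sum_coupling_weight\<close> as well.\<close>

lemma coupling_weight_swap: "coupling_weight N a b i k = coupling_weight N b a k i"
  by (simp add: coupling_weight_def min.commute mult.commute)

text \<open>The minima average to at most the average of \<open>a\<close>, which is 1, so the
  denominator of the residual term cannot be negative.\<close>

lemma coupling_weight_nonneg:
  fixes a b :: "nat \<Rightarrow> real"
  assumes "\<And>i. i < N \<Longrightarrow> 0 \<le> a i" "\<And>i. i < N \<Longrightarrow> 0 \<le> b i"
    and "(\<Sum>i<N. a i) = N" and "i < N" "k < N"
  shows "0 \<le> coupling_weight N a b i k"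
proof -
  have "(\<Sum>i<N. min (a i) (b i)) \<le> (\<Sum>i<N. a i)"
    by (intro sum_mono) auto
  then have "0 \<le> 1 - (\<Sum>i<N. min (a i) (b i)) / N"
    using assms by (simp add: field_simps)
  then show ?thesis
    using assms by (auto simp: coupling_weight_def intro!: add_nonneg_nonneg divide_nonneg_nonneg mult_nonneg_nonneg)
qed

text \<open>This is the first marginal of the coupling. The residuals of \<open>b\<close> sum to
  \<open>N * (1 - m)\<close>, which cancels the denominator; the diagonal part
  \<open>min (a i) (b i)\<close> and the residual of \<open>a\<close> then add up to
  \<open>a i\<close>.\<close>

lemma sum_coupling_weight:
  assumes a: "(\<Sum>i<N. a i) = N" and b: "(\<Sum>i<N. b i) = N" and i: "i < N"
  shows "(\<Sum>k<N. coupling_weight N a b i k) = a i / N"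
proof -
  define m where "m = (\<Sum>i<N. min (a i) (b i)) / N"
  have N: "N > 0" using i by simp
  have *: "(\<Sum>k<N. b k - min (a k) (b k)) = N * (1 - m)"
    using N b by (simp add: sum_subtractf m_def field_simps)
  have "(\<Sum>k<N. coupling_weight N a b i k) = min (a i) (b i) / N +
     (if m = 1 then 0 else (a i - min (a i) (b i)) / ((real N)\<^sup>2 * (1 - m)) * (\<Sum>k<N. b k - min (a k) (b k)))"
    using i unfolding coupling_weight_def m_def[symmetric] sum_distrib_left
    by (simp add: sum.distrib)
  also have "\<dots> = a i / N"
  proof (cases "m = 1")
    case True
    \<comment> \<open>Full overlap removes the residual term. Nonnegative residuals of
      \<open>a\<close> with sum zero all vanish, so the diagonal alone already carries
      \<open>a i\<close>.\<close>
    then have "(\<Sum>k<N. a k - min (a k) (b k)) = 0"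
      using N a by (simp add: sum_subtractf m_def field_simps)
    then have "\<forall>k\<in>{..<N}. a k - min (a k) (b k) = 0"
      by (subst (asm) sum_nonneg_eq_0_iff) auto
    then have "a i = min (a i) (b i)"
      using i by force
    then show ?thesis using True by simp
  next
    case False
    then show ?thesis
      unfolding * using N by (simp add: field_simps power2_eq_square)
  qed
  finally show ?thesis .
qed

section \<open>The selection operator at an empirical measure as a mixture of kernels\<close>

text \<open>A discrete law on index pairs followed by the mutation kernel is a genuine measure, and
  it agrees with the defining set function on every Borel set. This supplies the countable
  additivity without which \<open>measure_of\<close> would return the zero measure.\<close>

lemma Phibar_emp:
  fixes G :: "'u::second_countable_topology \<Rightarrow> real"
    and K :: "'u \<times> 'u \<Rightarrow> ('u \<times> 'u) measure" and x :: "nat \<Rightarrow> 'u \<times> 'u"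
  assumes N: "N \<ge> 1" and G: "\<And>u. 0 < G u"
    and K: "K \<in> borel \<rightarrow>\<^sub>M prob_algebra borel"
  defines "a \<equiv> \<lambda>i. Gnorm G (emp N x) 1 (fst (x i))"
    and "b \<equiv> \<lambda>i. Gnorm G (emp N x) 2 (snd (x i))"
  shows "Phibar G K (emp N x) =
    point_measure ({..<N} \<times> {..<N}) (\<lambda>(i, k). ennreal (coupling_weight N a b i k)) \<bind>
      (\<lambda>(i, k). K (fst (x i), snd (x k)))" (is "_ = Giry_Monad.bind ?P ?K")
    and "(\<Sum>i<N. a i) = N" "(\<Sum>i<N. b i) = N" "\<And>i. 0 \<le> a i" "\<And>i. 0 \<le> b i"
proof -
  have pos: "(\<Sum>i<N. G (fst (x i))) > 0" "(\<Sum>i<N. G (snd (x i))) > 0"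
    using N G by (auto intro!: sum_pos simp: lessThan_empty_iff)
  show a: "(\<Sum>i<N. a i) = N" and b: "(\<Sum>i<N. b i) = N"
    using N pos by (simp_all add: a_def b_def Gnorm_def comp_def integral_emp sum_divide_distrib[symmetric] sum_distrib_right[symmetric])
  show a0: "0 \<le> a i" and b0: "0 \<le> b i" for i
    by (auto simp: a_def b_def Gnorm_def comp_def integral_emp[OF N]
        intro!: divide_nonneg_nonneg mult_nonneg_nonneg sum_nonneg less_imp_le[OF G])
  define g where "g i = min (a i) (b i)" for i
  define m where "m = (\<Sum>i<N. g i) / N"
  have Gbar: "Gbar G (emp N x) (x i) = g i" for i
    by (simp add: Gbar_def g_def a_def b_def)
  have K': "?K \<in> ?P \<rightarrow>\<^sub>M subprob_algebra borel"
    using measurable_space[OF K] unfolding point_measure_def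
    by (auto simp: space_prob_algebra space_subprob_algebra prob_space_imp_subprob_space split: prod.splits)
  have neP: "space ?P \<noteq> {}"
    using N by (auto simp: space_point_measure lessThan_empty_iff)
  have psK: "prob_space (K v)" "sets (K v) = sets borel" for v
    using measurable_space[OF K, of v] by (auto simp: space_prob_algebra)
  have w: "0 \<le> coupling_weight N a b i k" if "i < N" "k < N" for i k
    using that a0 b0 a by (intro coupling_weight_nonneg) auto
  \<comment> \<open>Both normalised potentials average to 1 and the minima average to
    \<open>m\<close>, so the two normalising constants of the residual term coincide.\<close>
  have D1: "(\<integral>v. Gnorm G (emp N x) 1 (fst v) - Gbar G (emp N x) v \<partial>emp N x) = 1 - m"
    and D2: "(\<integral>v. Gnorm G (emp N x) 2 (snd v) - Gbar G (emp N x) v \<partial>emp N x) = 1 - m"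
    unfolding integral_emp[OF N] Gbar using a b N
    by (simp_all add: a_def b_def sum_subtractf m_def diff_divide_distrib)
  have m1: "m \<le> 1"
  proof -
    have "(\<Sum>i<N. g i) \<le> (\<Sum>i<N. a i)" by (intro sum_mono) (auto simp: g_def)
    then show ?thesis using a N by (simp add: m_def field_simps)
  qed
  define q where "q A i k = measure (K (fst (x i), snd (x k))) A" for A i k
  have "emeasure (?P \<bind> ?K) A = ennreal ((\<Sum>i<N. g i * q A i i) / N) +
     (if m = 1 then 0 else ennreal ((1 - m) * ((\<Sum>i<N. (\<Sum>k<N. ((a i - g i) / (1 - m)) * ((b k - g k) / (1 - m)) * q A i k) / N) / N)))"
    (is "_ = ennreal ?S + (if _ then 0 else ennreal ?T)")
    if A: "A \<in> sets borel" for A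
  proof -
    have "emeasure (?P \<bind> ?K) A = (\<Sum>(i,k)\<in>{..<N} \<times> {..<N}. ennreal (coupling_weight N a b i k * q A i k))"
      unfolding emeasure_bind[OF neP K' A]
      apply (subst nn_integral_point_measure_finite)
       apply simp
      apply (intro sum.cong refl)
      apply (auto simp: q_def ennreal_mult w finite_measure.emeasure_eq_measure[OF prob_space.finite_measure[OF psK(1)]])
      done
    also have "\<dots> = ennreal (\<Sum>i<N. \<Sum>k<N. coupling_weight N a b i k * q A i k)"
      unfolding sum.cartesian_product
      by (subst sum_ennreal[symmetric]) (auto simp: q_def w intro!: sum.cong)
    also have "(\<Sum>i<N. \<Sum>k<N. coupling_weight N a b i k * q A i k) = ?S + (if m = 1 then 0 else ?T)"
    proof -
      \<comment> \<open>The prefactor \<open>1 - m\<close> cancels one of the two normalising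
        constants; what is left is the single factor \<open>1 - m\<close> in the denominator of
        \<open>coupling_weight\<close>.\<close>
      have alg: "s * (p / s * (q / s) * r / n / n) = p * q / (n\<^sup>2 * s) * r" if "s \<noteq> 0" "n \<noteq> 0" for s p q r n :: real
        using that by (simp add: field_simps power2_eq_square)
      have "coupling_weight N a b i k * q A i k = (if i = k then g i * q A i i / N else 0) +
         (if m = 1 then 0 else (1 - m) * (((a i - g i) / (1 - m)) * ((b k - g k) / (1 - m)) * q A i k / N / N))" for i k
        using N alg[of "1 - m" "real N" "a i - g i" "b k - g k" "q A i k"]
        unfolding coupling_weight_def g_def[symmetric] m_def[symmetric]
        by (auto simp: distrib_right)
      then show ?thesis
        by (simp add: sum.distrib sum_divide_distrib sum_distrib_left)
    qed
    also have "ennreal \<dots> = ennreal ?S + (if m = 1 then 0 else ennreal ?T)"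
    proof -
      have "0 \<le> ?S" using a0 b0
        by (auto intro!: divide_nonneg_nonneg sum_nonneg mult_nonneg_nonneg simp: g_def q_def)
      moreover have "0 \<le> ?T" using m1
        by (intro divide_nonneg_nonneg sum_nonneg mult_nonneg_nonneg) (auto simp: g_def q_def)
      ultimately show ?thesis by (auto simp: ennreal_plus)
    qed
    finally show ?thesis .
  qed
  note eq = this
  have sets: "sets (?P \<bind> ?K) = sets borel"
    using psK neP by (intro sets_bind) auto
  have "?P \<bind> ?K = measure_of UNIV (sets borel) (emeasure (?P \<bind> ?K))"
    using measure_of_of_measure[of "?P \<bind> ?K"] sets_eq_imp_space_eq[OF sets] unfolding sets by simp
  also have "\<dots> = Phibar G K (emp N x)"
    unfolding Phibar_def
  proof (rule measure_of_eq)
    fix A :: "('u \<times> 'u) set" assume "A \<in> sigma_sets UNIV (sets borel)"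
    then have A: "A \<in> sets borel"
      using sets.sigma_sets_eq[of "borel :: ('u \<times> 'u) measure"] by simp
    show "emeasure (?P \<bind> ?K) A = ennreal (\<integral>v. Gbar G (emp N x) v * measure (K v) A \<partial>emp N x) +
     (if (\<integral>v. Gbar G (emp N x) v \<partial>emp N x) = 1 then 0 else
      ennreal ((1 - (\<integral>v. Gbar G (emp N x) v \<partial>emp N x)) *
        (\<integral>v. (\<integral>w.
            ((Gnorm G (emp N x) 1 (fst v) - Gbar G (emp N x) v) /
               (\<integral>y. Gnorm G (emp N x) 1 (fst y) - Gbar G (emp N x) y \<partial>emp N x)) *
            ((Gnorm G (emp N x) 2 (snd w) - Gbar G (emp N x) w) /
               (\<integral>y. Gnorm G (emp N x) 2 (snd y) - Gbar G (emp N x) y \<partial>emp N x)) *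
            measure (K (fst v, snd w)) A \<partial>emp N x) \<partial>emp N x)))"
      unfolding eq[OF A] D1 D2
      unfolding integral_emp[OF N] Gbar m_def[symmetric]
      by (simp add: q_def a_def b_def)
  qed simp
  finally show "Phibar G K (emp N x) = ?P \<bind> ?K" ..
qed

section \<open>Second moment of an i.i.d. average, and measurability of product laws\<close>

text \<open>This is a bias-variance decomposition. Independence removes the cross terms of the
  centred values, leaving a variance of order \<open>1 / N\<close> plus the squared bias. In the
  particle step, \<open>A\<close> is the factor fixed by the past and \<open>g\<close> is the
  target.\<close>

lemma nn_integral_square_iid_mean_le:
  fixes f :: "'a \<Rightarrow> real" and N :: nat
  assumes Q: "prob_space Q" and f: "f \<in> borel_measurable Q"
    and b: "\<And>x. \<bar>f x\<bar> \<le> b" and N: "N \<ge> 1"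
  shows "(\<integral>\<^sup>+x. ennreal ((A * ((\<Sum>i<N. f (x i)) / N) - g)\<^sup>2) \<partial>PiM {..<N} (\<lambda>_. Q))
    \<le> ennreal (A\<^sup>2 * b\<^sup>2 / N + (A * (\<integral>x. f x \<partial>Q) - g)\<^sup>2)"
proof -
  interpret Q: prob_space Q by fact
  interpret P: finite_product_prob_space "\<lambda>_. Q" "{..<N}"
    by unfold_locales simp
  let ?P = "PiM {..<N} (\<lambda>_. Q)"
  define m where "m = (\<integral>x. f x \<partial>Q)"
  define h where "h x = f x - m" for x
  note [measurable] = f
  have intf: "integrable Q f"
    using b by (intro Q.integrable_const_bound[where B=b]) auto
  have [measurable]: "h \<in> borel_measurable Q" unfolding h_def by simp
  have hb: "\<bar>h x\<bar> \<le> b + \<bar>m\<bar>" for x using b[of x] unfolding h_def by linarith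
  have b0: "0 \<le> b" using b[of undefined] by linarith
  have inth: "integrable Q h" unfolding h_def using intf by simp
  have h0: "(\<integral>x. h x \<partial>Q) = 0"
    unfolding h_def using intf by (simp add: m_def Q.prob_space)
  have intf2: "integrable Q (\<lambda>x. (f x)\<^sup>2)"
    by (intro Q.integrable_const_bound[where B="b\<^sup>2"]) (auto simp: power2_le_iff_abs_le b0 b)
  \<comment> \<open>Centring does not increase the second moment, which gives the constant
    \<open>b\<close> squared in place of the cruder bound available from \<open>hb\<close>.\<close>
  have h2: "(\<integral>x. (h x)\<^sup>2 \<partial>Q) \<le> b\<^sup>2"
  proof -
    have "(\<integral>x. (h x)\<^sup>2 \<partial>Q) \<le> (\<integral>x. (f x)\<^sup>2 \<partial>Q)"
      using Q.variance_eq[OF intf intf2] by (simp add: h_def m_def)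
    also have "\<dots> \<le> (\<integral>x. b\<^sup>2 \<partial>Q)"
      using intf2 by (intro integral_mono) (auto simp: power2_le_iff_abs_le b0 b)
    finally show ?thesis by (simp add: Q.prob_space)
  qed
  have comp: "(\<integral>x. r (x i) \<partial>?P) = (\<integral>x. r x \<partial>Q)" if "i < N" "r \<in> borel_measurable Q" for i and r :: "'a \<Rightarrow> real"
  proof -
    have "(\<integral>x. r x \<partial>Q) = (\<integral>x. r x \<partial>distr ?P Q (\<lambda>x. x i))"
      using that by (subst distr_PiM_component) (auto simp: Q)
    also have "\<dots> = (\<integral>x. r (x i) \<partial>?P)"
      using that by (intro integral_distr) auto
    finally show ?thesis ..
  qed
  have int1: "integrable ?P (\<lambda>x. h (x i))" if "i < N" for i
    using that hb by (intro P.P.integrable_const_bound[where B="b + \<bar>m\<bar>"]) auto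
  have int2: "integrable ?P (\<lambda>x. h (x i) * h (x k))" if "i < N" "k < N" for i k
    using that hb by (intro P.P.integrable_const_bound[where B="(b + \<bar>m\<bar>) * (b + \<bar>m\<bar>)"])
      (auto simp: abs_mult b0 intro!: mult_mono AE_I2)
  have cross: "(\<integral>x. h (x i) * h (x k) \<partial>?P) = (if i = k then (\<integral>x. (h x)\<^sup>2 \<partial>Q) else 0)"
    if "i < N" "k < N" for i k
  proof (cases "i = k")
    case True
    then show ?thesis
      using comp[of i "\<lambda>x. (h x)\<^sup>2"] that by (simp add: power2_eq_square)
  next
    case False
    \<comment> \<open>The off-diagonal product is written as a product over all coordinates, with
      the constant 1 away from \<open>i\<close> and \<open>k\<close>. Its integral then factorises,
      and the factor at \<open>i\<close> is the mean of \<open>h\<close>, namely zero.\<close>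
    define r where "r l = (if l = i \<or> l = k then h else (\<lambda>_. 1))" for l
    have "(\<integral>x. (\<Prod>l<N. r l (x l)) \<partial>?P) = (\<Prod>l<N. integral\<^sup>L Q (r l))"
      by (intro P.product_integral_prod) (auto simp: r_def inth)
    also have "\<dots> = 0"
      using that h0 by (auto simp: r_def intro!: bexI[of _ i])
    also have "(\<lambda>x. \<Prod>l<N. r l (x l)) = (\<lambda>x. h (x i) * h (x k))"
    proof
      fix x
      have "(\<Prod>l<N. r l (x l)) = (\<Prod>l\<in>{i,k}. r l (x l))"
        using that by (intro prod.mono_neutral_right) (auto simp: r_def)
      then show "(\<Prod>l<N. r l (x l)) = h (x i) * h (x k)"
        using False by (simp add: r_def)
    qed
    finally show ?thesis using False by simp
  qed
  define H where "H x = (\<Sum>i<N. h (x i))" for x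
  have H2: "(H x)\<^sup>2 = (\<Sum>i<N. \<Sum>k<N. h (x i) * h (x k))" for x
    by (simp add: H_def power2_eq_square sum_product)
  have intH: "integrable ?P H" "(\<integral>x. H x \<partial>?P) = 0"
    unfolding H_def using int1 comp[of _ h] h0 by (auto simp: Bochner_Integration.integral_sum)
  have intH2: "integrable ?P (\<lambda>x. (H x)\<^sup>2)"
    unfolding H2 by (intro Bochner_Integration.integrable_sum int2) auto
  have EH2: "(\<integral>x. (H x)\<^sup>2 \<partial>?P) = N * (\<integral>x. (h x)\<^sup>2 \<partial>Q)"
  proof -
    have "(\<integral>x. (H x)\<^sup>2 \<partial>?P) = (\<Sum>i<N. \<Sum>k<N. \<integral>x. h (x i) * h (x k) \<partial>?P)"
      unfolding H2 by (subst Bochner_Integration.integral_sum, force intro!: int2)+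
        (intro sum.cong refl Bochner_Integration.integral_sum int2; simp)
    also have "\<dots> = (\<Sum>i<N. \<Sum>k<N. if i = k then (\<integral>x. (h x)\<^sup>2 \<partial>Q) else 0)"
      by (intro sum.cong refl cross) auto
    finally show ?thesis by simp
  qed
  \<comment> \<open>The bias: the error is \<open>A / N * H x + d\<close>, and the mixed term
    integrates to zero because \<open>H\<close> is centred.\<close>
  define d where "d = A * m - g"
  have eq: "(A * ((\<Sum>i<N. f (x i)) / N) - g)\<^sup>2 = (A / N)\<^sup>2 * (H x)\<^sup>2 + (2 * A / N * d) * H x + d\<^sup>2" for x
  proof -
    have "A * ((\<Sum>i<N. f (x i)) / N) - g = A / N * H x + d"
      using N by (simp add: H_def h_def sum_subtractf d_def field_simps)
    then show ?thesis by (simp add: power2_eq_square algebra_simps)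
  qed
  have int: "integrable ?P (\<lambda>x. (A * ((\<Sum>i<N. f (x i)) / N) - g)\<^sup>2)"
    unfolding eq using intH intH2 by auto
  have "(\<integral>x. (A * ((\<Sum>i<N. f (x i)) / N) - g)\<^sup>2 \<partial>?P) = (A / N)\<^sup>2 * (N * (\<integral>x. (h x)\<^sup>2 \<partial>Q)) + d\<^sup>2"
    unfolding eq using intH intH2 EH2 by (simp add: P.P.prob_space)
  also have "\<dots> \<le> (A / N)\<^sup>2 * (N * b\<^sup>2) + d\<^sup>2"
    using h2 by (intro add_right_mono mult_left_mono) auto
  also have "\<dots> = A\<^sup>2 * b\<^sup>2 / N + d\<^sup>2"
    using N by (simp add: field_simps power2_eq_square)
  finally show ?thesis
    using int by (subst nn_integral_eq_integral) (auto simp: d_def m_def simp del: ennreal_plus intro!: ennreal_leI)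
qed

text \<open>Boxes form an intersection-stable generator of the product sigma-algebra, and the mass
  of a box is a finite product of kernel masses, each measurable in the parameter.\<close>

lemma measurable_PiM_prob_algebra:
  assumes K: "K \<in> L \<rightarrow>\<^sub>M prob_algebra R" and I: "finite I"
  shows "(\<lambda>x. PiM I (\<lambda>_. K x)) \<in> L \<rightarrow>\<^sub>M prob_algebra (PiM I (\<lambda>_. R))"
proof (rule measurable_prob_algebra_generated[OF sets_PiM Int_stable_prod_algebra prod_algebra_sets_into_space])
  have Kx: "sets (K x) = sets R" "prob_space (K x)" if "x \<in> space L" for x
    using measurable_space[OF K that] by (auto simp: space_prob_algebra)
  fix x assume "x \<in> space L"
  then show "prob_space (PiM I (\<lambda>_. K x))" "sets (PiM I (\<lambda>_. K x)) = sets (PiM I (\<lambda>_. R))"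
    using Kx by (auto intro!: prob_space_PiM sets_PiM_cong)
next
  have Kx: "sets (K x) = sets R" "prob_space (K x)" if "x \<in> space L" for x
    using measurable_space[OF K that] by (auto simp: space_prob_algebra)
  fix A assume "A \<in> prod_algebra I (\<lambda>_. R)"
  then obtain E where A: "A = (\<Pi>\<^sub>E i\<in>I. E i)" and E: "\<And>i. i \<in> I \<Longrightarrow> E i \<in> sets R"
    using I by (auto simp: prod_algebra_eq_finite)
  have "(\<lambda>x. \<Prod>i\<in>I. emeasure (K x) (E i)) \<in> borel_measurable L"
    using E by (intro borel_measurable_prod_ennreal measurable_emeasure_kernel[OF measurable_prob_algebraD[OF K]])
  moreover have "emeasure (PiM I (\<lambda>_. K x)) A = (\<Prod>i\<in>I. emeasure (K x) (E i))" if "x \<in> space L" for x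
  proof -
    interpret prob_space "K x" using Kx that by simp
    interpret product_sigma_finite "\<lambda>_. K x" by unfold_locales
    show ?thesis using E I Kx that by (simp add: A emeasure_PiM)
  qed
  ultimately show "(\<lambda>x. emeasure (PiM I (\<lambda>_. K x)) A) \<in> borel_measurable L"
    by (simp cong: measurable_cong)
qed


section \<open>Mass, marginal means and measurability of the selection operator\<close>

lemma
  fixes G :: "'u::second_countable_topology \<Rightarrow> real"
    and K :: "'u \<times> 'u \<Rightarrow> ('u \<times> 'u) measure" and x :: "nat \<Rightarrow> 'u \<times> 'u"
  assumes N: "N \<ge> 1" and G: "\<And>u. 0 < G u"
    and K: "K \<in> borel \<rightarrow>\<^sub>M prob_algebra borel"
  defines "a \<equiv> \<lambda>i. Gnorm G (emp N x) 1 (fst (x i))"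
    and "b \<equiv> \<lambda>i. Gnorm G (emp N x) 2 (snd (x i))"
  shows sets_Phibar_emp: "sets (Phibar G K (emp N x)) = sets borel"
    and emeasure_Phibar_emp: "\<And>A. A \<in> sets borel \<Longrightarrow> emeasure (Phibar G K (emp N x)) A =
      (\<Sum>(i,k)\<in>{..<N}\<times>{..<N}. ennreal (coupling_weight N a b i k) * emeasure (K (fst (x i), snd (x k))) A)"
    and prob_space_Phibar_emp: "prob_space (Phibar G K (emp N x))"
    and integral_Phibar_emp: "\<And>(f :: 'u \<times> 'u \<Rightarrow> real) B. f \<in> borel_measurable borel \<Longrightarrow> (\<And>v. \<bar>f v\<bar> \<le> B) \<Longrightarrow>
      (\<integral>v. f v \<partial>Phibar G K (emp N x)) =
      (\<Sum>i<N. \<Sum>k<N. coupling_weight N a b i k * (\<integral>v. f v \<partial>K (fst (x i), snd (x k))))"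
proof -
  have ab: "(\<Sum>i<N. a i) = N" "(\<Sum>i<N. b i) = N" "\<And>i. 0 \<le> a i" "\<And>i. 0 \<le> b i"
    unfolding a_def b_def by (rule Phibar_emp(2-5)[where x=x and G=G, OF N G K])+
  let ?P = "point_measure ({..<N} \<times> {..<N}) (\<lambda>(i, k). ennreal (coupling_weight N a b i k))"
  let ?K = "\<lambda>(i, k). K (fst (x i), snd (x k))"
  have eq: "Phibar G K (emp N x) = Giry_Monad.bind ?P ?K"
    using Phibar_emp(1)[where x=x and G=G, OF N G K] unfolding a_def b_def .
  have psK: "prob_space (K v)" "sets (K v) = sets borel" for v
    using measurable_space[OF K, of v] by (auto simp: space_prob_algebra)
  have K': "?K \<in> ?P \<rightarrow>\<^sub>M subprob_algebra borel"
    using psK unfolding point_measure_def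
    by (auto simp: space_subprob_algebra prob_space_imp_subprob_space split: prod.splits)
  have neP: "space ?P \<noteq> {}"
    using N by (auto simp: space_point_measure lessThan_empty_iff)
  have w: "0 \<le> coupling_weight N a b i k" if "i < N" "k < N" for i k
    using that ab by (intro coupling_weight_nonneg) auto
  show sets: "sets (Phibar G K (emp N x)) = sets borel"
    unfolding eq using psK neP by (intro sets_bind) auto
  show em: "emeasure (Phibar G K (emp N x)) A =
      (\<Sum>(i,k)\<in>{..<N}\<times>{..<N}. ennreal (coupling_weight N a b i k) * emeasure (K (fst (x i), snd (x k))) A)"
    if "A \<in> sets borel" for A
    unfolding eq emeasure_bind[OF neP K' that]
    by (subst nn_integral_point_measure_finite) (auto intro!: sum.cong)
  show "prob_space (Phibar G K (emp N x))"
  proof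
    have "emeasure (K v) UNIV = 1" for v
      using prob_space.emeasure_space_1[OF psK(1)[of v]] sets_eq_imp_space_eq[OF psK(2)[of v]] by simp
    then have "emeasure (Phibar G K (emp N x)) UNIV = (\<Sum>(i,k)\<in>{..<N}\<times>{..<N}. ennreal (coupling_weight N a b i k))"
      by (simp add: em)
    also have "\<dots> = ennreal (\<Sum>i<N. \<Sum>k<N. coupling_weight N a b i k)"
      unfolding sum.cartesian_product
      by (subst sum_ennreal[symmetric]) (auto simp: w intro!: sum.cong)
    \<comment> \<open>Summing out the second index leaves the first marginal, whose total mass is
      the average of \<open>a\<close>, that is, 1.\<close>
    also have "(\<Sum>i<N. \<Sum>k<N. coupling_weight N a b i k) = (\<Sum>i<N. a i / N)"
      using ab by (intro sum.cong refl sum_coupling_weight) auto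
    also have "\<dots> = 1"
      using N ab by (simp add: sum_divide_distrib[symmetric])
    finally show "emeasure (Phibar G K (emp N x)) (space (Phibar G K (emp N x))) = 1"
      using sets_eq_imp_space_eq[OF sets] by simp
  qed
  show "(\<integral>v. f v \<partial>Phibar G K (emp N x)) =
      (\<Sum>i<N. \<Sum>k<N. coupling_weight N a b i k * (\<integral>v. f v \<partial>K (fst (x i), snd (x k))))"
    if f: "f \<in> borel_measurable borel" and B: "\<And>v. \<bar>f v\<bar> \<le> B" for f :: "'u \<times> 'u \<Rightarrow> real" and B
  proof -
    have "finite_measure ?P"
      by (intro finite_measureI) (simp add: space_point_measure emeasure_point_measure_finite split: prod.splits)
    then have "(\<integral>v. f v \<partial>Phibar G K (emp N x)) = (\<integral>ik. integral\<^sup>L (?K ik) f \<partial>?P)"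
      unfolding eq using prob_space.emeasure_space_1[OF psK(1)]
      by (intro integral_bind[OF f B K', where B'=1]) (auto split: prod.splits)
    \<comment> \<open>The density is put in the form \<open>ennreal\<close> of one real function, to
      which the finite-sum formula for the integral applies.\<close>
    also have "?P = point_measure ({..<N} \<times> {..<N}) (\<lambda>ik. ennreal (case ik of (i, k) \<Rightarrow> coupling_weight N a b i k))"
      by (intro arg_cong2[where f=point_measure] refl) (auto simp: fun_eq_iff)
    also have "(\<integral>ik. integral\<^sup>L (?K ik) f \<partial>\<dots>) =
      (\<Sum>ik\<in>{..<N} \<times> {..<N}. (case ik of (i, k) \<Rightarrow> coupling_weight N a b i k) *\<^sub>R integral\<^sup>L (?K ik) f)"
      using w by (intro lebesgue_integral_point_measure_finite) auto
    finally show ?thesis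
      by (simp add: sum.cartesian_product split_def)
  qed
qed

text \<open>After mutation, component \<open>j\<close> has a mean depending only on component
  \<open>j\<close> of the selected pair. Summing out the other index replaces the coupling by its
  marginal, so the coupling leaves this mean equal to that of ordinary selection with potential
  \<open>G\<close>.\<close>

lemma integral_Phibar_emp_comp:
  fixes G :: "'u::second_countable_topology \<Rightarrow> real"
    and K :: "'u \<times> 'u \<Rightarrow> ('u \<times> 'u) measure" and x :: "nat \<Rightarrow> 'u \<times> 'u"
  assumes N: "N \<ge> 1" and G: "\<And>u. 0 < G u"
    and K: "K \<in> borel \<rightarrow>\<^sub>M prob_algebra borel"
    and j: "j \<in> {1, 2}"
    and f: "f \<in> borel_measurable borel" and B: "\<And>u. \<bar>f u\<bar> \<le> B"
    and r: "\<And>v. (\<integral>v'. f (comp j v') \<partial>K v) = r (comp j v)"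
  shows "(\<integral>v. f (comp j v) \<partial>Phibar G K (emp N x)) =
    (\<integral>v. G (comp j v) * r (comp j v) \<partial>emp N x) / (\<integral>v. G (comp j v) \<partial>emp N x)"
proof -
  define a where "a = (\<lambda>i. Gnorm G (emp N x) 1 (fst (x i)))"
  define b where "b = (\<lambda>i. Gnorm G (emp N x) 2 (snd (x i)))"
  have ab: "(\<Sum>i<N. a i) = N" "(\<Sum>i<N. b i) = N" "\<And>i. 0 \<le> a i" "\<And>i. 0 \<le> b i"
    unfolding a_def b_def by (rule Phibar_emp(2-5)[where x=x and G=G, OF N G K])+
  have "(\<integral>v. f (comp j v) \<partial>Phibar G K (emp N x)) =
    (\<Sum>i<N. \<Sum>k<N. coupling_weight N a b i k * r (comp j (fst (x i), snd (x k))))"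
    unfolding integral_Phibar_emp[where f="\<lambda>v. f (comp j v)" and G=G, OF N G K measurable_compose[OF measurable_comp f] B] r
    by (simp add: a_def b_def)
  also have "\<dots> = (\<Sum>i<N. Gnorm G (emp N x) j (comp j (x i)) / N * r (comp j (x i)))"
  proof (cases "j = 1")
    case True
    have "(\<Sum>k<N. coupling_weight N a b i k * r (fst (x i))) = a i / N * r (fst (x i))" if "i < N" for i
      unfolding sum_distrib_right[symmetric] using ab that by (subst sum_coupling_weight) auto
    then show ?thesis using True by (simp add: comp_def a_def)
  next
    case False
    \<comment> \<open>For the second component the roles of the indices are exchanged: the weights
      are transposed so that the first-marginal formula applies to \<open>b\<close>.\<close>
    have "(\<Sum>i<N. coupling_weight N a b i k * r (snd (x k))) = b k / N * r (snd (x k))" if "k < N" for k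
      unfolding sum_distrib_right[symmetric] coupling_weight_swap[of N a b]
      using ab that by (subst sum_coupling_weight) auto
    then show ?thesis using False j by (subst sum.swap) (simp add: comp_def b_def)
  qed
  also have "\<dots> = (\<integral>v. G (comp j v) * r (comp j v) \<partial>emp N x) / (\<integral>v. G (comp j v) \<partial>emp N x)"
    unfolding Gnorm_def integral_emp[OF N, where f="\<lambda>v. G (comp j v) * r (comp j v)"]
    by (simp add: sum_divide_distrib mult_ac)
  finally show ?thesis .
qed

text \<open>The mass of each Borel set is a finite sum of weights times kernel masses, and each of
  these is measurable in the configuration.\<close>

lemma measurable_Phibar_emp:
  fixes G :: "'u::second_countable_topology \<Rightarrow> real"
    and K :: "'u \<times> 'u \<Rightarrow> ('u \<times> 'u) measure"
  assumes N: "N \<ge> 1" and G: "\<And>u. 0 < G u" and Gm[measurable]: "G \<in> borel_measurable borel"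
    and K: "K \<in> borel \<rightarrow>\<^sub>M prob_algebra borel"
  shows "(\<lambda>x. Phibar G K (emp N x)) \<in> PiM {..<N} (\<lambda>_. borel) \<rightarrow>\<^sub>M prob_algebra borel"
proof (rule measurable_prob_algebra_generated[where G="sets borel" and \<Omega>=UNIV])
  show "sets borel = sigma_sets UNIV (sets (borel :: ('u \<times> 'u) measure))"
    using sets.sigma_sets_eq[of "borel :: ('u \<times> 'u) measure"] by simp
  show "Int_stable (sets (borel :: ('u \<times> 'u) measure))" by (rule sets.Int_stable)
  show "prob_space (Phibar G K (emp N x))" "sets (Phibar G K (emp N x)) = sets borel" for x
    by (rule prob_space_Phibar_emp[where G=G, OF N G K] sets_Phibar_emp[where G=G, OF N G K])+
  fix A :: "('u \<times> 'u) set" assume A: "A \<in> sets borel"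
  have [measurable]: "(fst :: 'u \<times> 'u \<Rightarrow> 'u) \<in> borel \<rightarrow>\<^sub>M borel" "(snd :: 'u \<times> 'u \<Rightarrow> 'u) \<in> borel \<rightarrow>\<^sub>M borel"
    by (auto intro!: borel_measurable_continuous_onI continuous_intros)
  have KA: "(\<lambda>v. emeasure (K v) A) \<in> borel_measurable borel"
    using A measurable_prob_algebraD[OF K] by (rule measurable_emeasure_kernel[rotated])
  have [measurable]: "(\<lambda>x. emeasure (K (fst (x i), snd (x k))) A) \<in> borel_measurable (PiM {..<N} (\<lambda>_. borel))"
    if [measurable]: "i \<in> {..<N}" "k \<in> {..<N}" for i k
  proof (rule measurable_compose[OF _ KA])
    show "(\<lambda>x. (fst (x i), snd (x k))) \<in> PiM {..<N} (\<lambda>_. borel) \<rightarrow>\<^sub>M (borel :: ('u \<times> 'u) measure)"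
      \<comment> \<open>Second countability identifies the Borel sets of pairs with the product
        sigma-algebra, so recombining components of two different particles is measurable.\<close>
      unfolding borel_prod[symmetric] by measurable
  qed
  have *: "(\<lambda>x. coupling_weight N (\<lambda>i. Gnorm G (emp N x) 1 (fst (x i))) (\<lambda>i. Gnorm G (emp N x) 2 (snd (x i))) i k)
     \<in> borel_measurable (PiM {..<N} (\<lambda>_. borel))" 
    if [measurable]: "i \<in> {..<N}" "k \<in> {..<N}" for i k
    unfolding coupling_weight_def Gnorm_def integral_emp[OF N] comp_def by measurable
  show "(\<lambda>x. emeasure (Phibar G K (emp N x)) A) \<in> borel_measurable (PiM {..<N} (\<lambda>_. borel))"
    unfolding emeasure_Phibar_emp[where G=G, OF N G K A]
    using * by (intro borel_measurable_sum) auto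
qed simp

section \<open>One coupled particle system: bounds and laws of trajectories\<close>

text \<open>The data of a single level, isolated so that the induction over time is done once and
  then instantiated at each level with the same \<open>G\<close> and \<open>c\<close>.\<close>

locale coupled_system =
  fixes G :: "nat \<Rightarrow> 'u::second_countable_topology \<Rightarrow> real" and c :: real
    and eta0 :: "('u \<times> 'u) measure"
    and M :: "nat \<Rightarrow> 'u \<times> 'u \<Rightarrow> ('u \<times> 'u) measure"
    and Mj :: "nat \<Rightarrow> nat \<Rightarrow> 'u \<Rightarrow> 'u measure"
  assumes G_pos: "0 < G p u" and G_le: "G p u \<le> c"
    and G_measurable: "G p \<in> borel_measurable borel"
    and eta0: "eta0 \<in> space (prob_algebra borel)"
    and M_kernel: "p \<ge> 1 \<Longrightarrow> M p \<in> borel \<rightarrow>\<^sub>M prob_algebra borel"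
    and Mj_kernel: "p \<ge> 1 \<Longrightarrow> j \<in> {1, 2} \<Longrightarrow> Mj p j \<in> borel \<rightarrow>\<^sub>M prob_algebra borel"
    and marginal: "p \<ge> 1 \<Longrightarrow> j \<in> {1, 2} \<Longrightarrow> (\<phi> :: 'u \<Rightarrow> real) \<in> borel_measurable borel \<Longrightarrow> bounded (range \<phi>) \<Longrightarrow>
      (\<integral>v'. \<phi> (comp j v') \<partial>M p v) = (\<integral>u'. \<phi> u' \<partial>Mj p j (comp j v))"
begin

abbreviation "conf_space N \<equiv> PiM {..<N} (\<lambda>_. borel :: ('u \<times> 'u) measure)"
abbreviation "path_space N p \<equiv> PiM {..p} (\<lambda>_::nat. conf_space N)"

lemma c_pos: "0 < c"
  using G_pos G_le by (rule less_le_trans)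

lemma measurable_emp_integral:
  fixes \<phi> :: "'u \<Rightarrow> real"
  assumes "N \<ge> 1" "q \<le> p" and [measurable]: "\<phi> \<in> borel_measurable borel"
  shows "(\<lambda>\<omega>. \<integral>v. \<phi> (comp j v) \<partial>emp N (\<omega> q)) \<in> borel_measurable (path_space N p)"
proof -
  note measurable_comp[measurable]
  have [measurable]: "(\<lambda>\<omega>. \<omega> q i) \<in> borel_measurable (path_space N p)" if "i \<in> {..<N}" for i
    using assms that
    by (intro measurable_compose[OF measurable_component_singleton[of q "{..p}"] measurable_component_singleton[of i "{..<N}"]]) auto
  show ?thesis unfolding integral_emp[OF \<open>N \<ge> 1\<close>] by measurable
qed

text \<open>The product runs over times strictly below \<open>n\<close>, so a path up to time
  \<open>p\<close> determines it as far as \<open>n = Suc p\<close>.\<close>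

lemma measurable_gammaN:
  assumes "N \<ge> 1" "n \<le> Suc p"
  shows "gammaN G N n j \<in> borel_measurable (path_space N p)"
  unfolding gammaN_def[abs_def] using assms G_measurable
  by (intro borel_measurable_prod measurable_emp_integral) auto

lemma gammaN_bounds:
  assumes "N \<ge> 1"
  shows "0 \<le> gammaN G N p j \<omega>" "gammaN G N p j \<omega> \<le> c ^ p"
proof -
  have *: "0 \<le> (\<integral>v. G q (comp j v) \<partial>emp N (\<omega> q)) \<and> (\<integral>v. G q (comp j v) \<partial>emp N (\<omega> q)) \<le> c" for q
  proof -
    have "(\<Sum>i<N. G q (comp j (\<omega> q i))) \<le> (\<Sum>i<N. c)"
      by (intro sum_mono G_le)
    then show ?thesis
      using assms G_pos[THEN less_imp_le] by (auto simp: integral_emp field_simps intro!: sum_nonneg)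
  qed
  then show "0 \<le> gammaN G N p j \<omega>" unfolding gammaN_def by (intro prod_nonneg) auto
  have "gammaN G N p j \<omega> \<le> (\<Prod>q<p. c)" unfolding gammaN_def using * by (intro prod_mono) auto
  then show "gammaN G N p j \<omega> \<le> c ^ p" by simp
qed

lemma measurable_transition:
  assumes N: "N \<ge> 1"
  shows "(\<lambda>\<omega>. PiM {..<N} (\<lambda>_. Phibar (G p) (M (Suc p)) (emp N (\<omega> p)))) \<in> path_space N p \<rightarrow>\<^sub>M prob_algebra (conf_space N)"
  by (intro measurable_PiM_prob_algebra measurable_compose[OF _ measurable_Phibar_emp[OF N G_pos G_measurable M_kernel]]
      measurable_component_singleton) auto

text \<open>Makes one time step a probability kernel between path spaces, as the \<open>bind\<close>
  in \<open>traj\<close> requires.\<close>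

lemma measurable_traj_step:
  assumes N: "N \<ge> 1"
  shows "(\<lambda>\<omega>. distr (PiM {..<N} (\<lambda>_. Phibar (G p) (M (Suc p)) (emp N (\<omega> p)))) (path_space N (Suc p))
    (\<lambda>x. fun_upd \<omega> (Suc p) x)) \<in> path_space N p \<rightarrow>\<^sub>M prob_algebra (path_space N (Suc p))"
  by (intro measurable_distr_prob_space2[OF measurable_transition[OF N]])
    (auto simp: split_def atMost_Suc intro!: measurable_fun_upd[where J="{..p}"])

lemma traj_in_space:
  assumes N: "N \<ge> 1"
  shows "traj eta0 M G N p \<in> space (prob_algebra (path_space N p))"
proof (induction p)
  case 0
  have "prob_space eta0" "sets eta0 = sets borel"
    using eta0 by (auto simp: space_prob_algebra)
  then have "prob_space (PiM {..<N} (\<lambda>_. eta0))" and s: "sets (PiM {..<N} (\<lambda>_. eta0)) = sets (conf_space N)"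
    by (auto intro!: prob_space_PiM sets_PiM_cong)
  then show ?case
    by (auto simp: space_prob_algebra measurable_cong_sets[OF s refl] intro!: prob_space.prob_space_distr measurable_restrict)
next
  case (Suc p)
  show ?case
    using measurable_space[OF measurable_bind_prob_space[OF measurable_ident measurable_traj_step[OF N]] Suc]
    by (simp add: id_def)
qed

lemma sets_traj: "N \<ge> 1 \<Longrightarrow> sets (traj eta0 M G N p) = sets (path_space N p)"
  and prob_space_traj: "N \<ge> 1 \<Longrightarrow> prob_space (traj eta0 M G N p)"
  using traj_in_space by (auto simp: space_prob_algebra)

section \<open>Mean square error of the marginal estimates of one level\<close>

text \<open>The test function and its bound are general because time \<open>p + 1\<close> with
  \<open>\<phi>\<close> reduces to time \<open>p\<close> with \<open>G M\<phi>\<close>, bounded by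
  \<open>c * b\<close>. Each sampling step, including the initial one, contributes at most the same
  variance, since \<open>c ^ p * (c * b) = c ^ Suc p * b\<close>; this gives the factor
  \<open>Suc p\<close>.\<close>

lemma mean_square_error:
  assumes N: "N \<ge> 1" and j: "j \<in> {1, 2}"
    and \<phi>: "\<phi> \<in> borel_measurable borel" and b: "\<And>u. \<bar>\<phi> u\<bar> \<le> b"
  shows "(\<integral>\<^sup>+\<omega>. ennreal ((gammaN G N p j \<omega> * (\<integral>v. \<phi> (comp j v) \<partial>emp N (\<omega> p)) - gammaFK eta0 Mj G j p \<phi>)\<^sup>2)
      \<partial>traj eta0 M G N p) \<le> ennreal (real (Suc p) * (c ^ p * b)\<^sup>2 / real N)"
  using \<phi> b
proof (induction p arbitrary: \<phi> b)
  case 0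
  have e: "prob_space eta0" "sets eta0 = sets borel"
    using eta0 by (auto simp: space_prob_algebra)
  then have s: "sets (PiM {..<N} (\<lambda>_. eta0)) = sets (conf_space N)"
    by (auto intro!: sets_PiM_cong)
  have f: "(\<lambda>v. \<phi> (comp j v)) \<in> borel_measurable eta0"
    using measurable_compose[OF measurable_comp 0(1)] by (simp add: measurable_cong_sets[OF e(2) refl])
  have restr: "(\<lambda>x. \<lambda>q\<in>{..0}. x) \<in> Pi\<^sub>M {..<N} (\<lambda>_. eta0) \<rightarrow>\<^sub>M path_space N 0"
    by (auto simp: measurable_cong_sets[OF s refl] intro!: measurable_restrict)
  have F_m: "(\<lambda>\<omega>. ennreal ((gammaN G N 0 j \<omega> * (\<integral>v. \<phi> (comp j v) \<partial>emp N (\<omega> 0)) - gammaFK eta0 Mj G j 0 \<phi>)\<^sup>2))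
      \<in> borel_measurable (path_space N 0)"
    using measurable_gammaN[OF N, of 0 0] measurable_emp_integral[OF N, of 0 0] 0 by measurable
  \<comment> \<open>At time 0 the empty product is 1, and the estimate is a plain i.i.d. average
    without bias.\<close>
  have "(\<integral>\<^sup>+\<omega>. ennreal ((gammaN G N 0 j \<omega> * (\<integral>v. \<phi> (comp j v) \<partial>emp N (\<omega> 0)) - gammaFK eta0 Mj G j 0 \<phi>)\<^sup>2)
      \<partial>traj eta0 M G N 0)
    = (\<integral>\<^sup>+x. ennreal ((1 * ((\<Sum>i<N. \<phi> (comp j (x i))) / N) - (\<integral>v. \<phi> (comp j v) \<partial>eta0))\<^sup>2)
      \<partial>PiM {..<N} (\<lambda>_. eta0))"
    unfolding traj.simps
    by (subst nn_integral_distr[OF restr]) (use F_m in \<open>simp_all add: gammaN_def integral_emp[OF N]\<close>)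
  also have "\<dots> \<le> ennreal (1\<^sup>2 * b\<^sup>2 / N + (1 * (\<integral>v. \<phi> (comp j v) \<partial>eta0) - (\<integral>v. \<phi> (comp j v) \<partial>eta0))\<^sup>2)"
    by (rule nn_integral_square_iid_mean_le[OF e(1) f 0(2) N])
  finally show ?case by simp
next
  case (Suc p)
  note [measurable] = Suc.prems(1) G_measurable
  define K where "K \<omega> = Phibar (G p) (M (Suc p)) (emp N (\<omega> p))" for \<omega> :: "nat \<Rightarrow> nat \<Rightarrow> 'u \<times> 'u"
  define r where "r u = (\<integral>u'. \<phi> u' \<partial>Mj (Suc p) j u)" for u
  \<comment> \<open>By the recursion of \<open>gammaFK\<close>, the target of \<open>\<phi>\<close>
    at time \<open>Suc p\<close> is the target of \<open>\<psi>\<close> at time \<open>p\<close>, so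
    one constant \<open>\<gamma>\<close> serves both times.\<close>
  define \<psi> where "\<psi> u = G p u * r u" for u
  define \<gamma> where "\<gamma> = gammaFK eta0 Mj G j (Suc p) \<phi>"
  \<comment> \<open>This is \<open>gammaN\<close> at \<open>Suc p\<close>, but determined by the
    path up to time \<open>p\<close>; it stays fixed while the new particles are integrated
    out.\<close>
  define A where "A \<omega> = gammaN G N p j \<omega> * (\<integral>v. G p (comp j v) \<partial>emp N (\<omega> p))" for \<omega>
  have Mj: "Mj (Suc p) j \<in> borel \<rightarrow>\<^sub>M prob_algebra borel"
    using j by (intro Mj_kernel) auto
  have r_m[measurable]: "r \<in> borel_measurable borel"
    unfolding r_def[abs_def]
    by (rule measurable_compose[OF measurable_prob_algebraD[OF Mj] integral_measurable_subprob_algebra]) simp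
  have r_b: "\<bar>r u\<bar> \<le> b" for u
  proof -
    have "Mj (Suc p) j u \<in> space (prob_algebra borel)"
      using measurable_space[OF Mj] by simp
    then have sp: "sets (Mj (Suc p) j u) = sets borel" and "prob_space (Mj (Suc p) j u)"
      by (auto simp: space_prob_algebra)
    then interpret prob_space "Mj (Suc p) j u" by simp
    have "integrable (Mj (Suc p) j u) \<phi>"
      using Suc.prems by (intro integrable_const_bound[where B=b]) (auto simp: measurable_cong_sets[OF sp refl])
    then have "\<bar>r u\<bar> \<le> (\<integral>u'. b \<partial>Mj (Suc p) j u)"
      unfolding r_def using Suc.prems by (intro order.trans[OF integral_abs_bound] integral_mono) auto
    then show ?thesis by (simp add: prob_space)
  qed
  have \<psi>_m: "\<psi> \<in> borel_measurable borel" unfolding \<psi>_def[abs_def] by simp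
  have \<psi>_b: "\<bar>\<psi> u\<bar> \<le> c * b" for u
    unfolding \<psi>_def abs_mult using r_b G_le G_pos c_pos by (intro mult_mono) (auto simp: less_imp_le)
  have IH: "(\<integral>\<^sup>+\<omega>. ennreal ((gammaN G N p j \<omega> * (\<integral>v. \<psi> (comp j v) \<partial>emp N (\<omega> p)) - \<gamma>)\<^sup>2) \<partial>traj eta0 M G N p)
      \<le> ennreal (real (Suc p) * (c ^ p * (c * b))\<^sup>2 / real N)"
    using Suc.IH[OF \<psi>_m \<psi>_b] by (simp add: \<gamma>_def \<psi>_def[abs_def] r_def)
  have K_m: "(\<lambda>\<omega>. distr (PiM {..<N} (\<lambda>_. K \<omega>)) (path_space N (Suc p)) (\<lambda>x. fun_upd \<omega> (Suc p) x))
      \<in> traj eta0 M G N p \<rightarrow>\<^sub>M subprob_algebra (path_space N (Suc p))"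
    using measurable_prob_algebraD[OF measurable_traj_step[OF N, of p]]
    unfolding K_def measurable_cong_sets[OF sets_traj[OF N] refl] .
  have F_m: "(\<lambda>\<omega>. ennreal ((gammaN G N (Suc p) j \<omega> * (\<integral>v. \<phi> (comp j v) \<partial>emp N (\<omega> (Suc p))) - \<gamma>)\<^sup>2))
      \<in> borel_measurable (path_space N (Suc p))"
    using measurable_gammaN[OF N, of "Suc p" "Suc p"] measurable_emp_integral[OF N, of "Suc p" "Suc p" \<phi>] by measurable
  have step: "(\<integral>\<^sup>+\<omega>'. ennreal ((gammaN G N (Suc p) j \<omega>' * (\<integral>v. \<phi> (comp j v) \<partial>emp N (\<omega>' (Suc p))) - \<gamma>)\<^sup>2)
        \<partial>distr (PiM {..<N} (\<lambda>_. K \<omega>)) (path_space N (Suc p)) (\<lambda>x. fun_upd \<omega> (Suc p) x))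
     \<le> ennreal ((c ^ Suc p * b)\<^sup>2 / N) + ennreal ((gammaN G N p j \<omega> * (\<integral>v. \<psi> (comp j v) \<partial>emp N (\<omega> p)) - \<gamma>)\<^sup>2)"
    if \<omega>: "\<omega> \<in> space (path_space N p)" for \<omega>
  proof -
    have M: "M (Suc p) \<in> borel \<rightarrow>\<^sub>M prob_algebra borel" by (simp add: M_kernel)
    have Kp: "prob_space (K \<omega>)" and Ks: "sets (K \<omega>) = sets borel"
      unfolding K_def by (rule prob_space_Phibar_emp[where G="G p", OF N G_pos M] sets_Phibar_emp[where G="G p", OF N G_pos M])+
    have s: "sets (PiM {..<N} (\<lambda>_. K \<omega>)) = sets (conf_space N)"
      using Ks by (intro sets_PiM_cong) auto
    have f: "(\<lambda>v. \<phi> (comp j v)) \<in> borel_measurable (K \<omega>)"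
      using measurable_compose[OF measurable_comp Suc.prems(1)] by (simp add: measurable_cong_sets[OF Ks refl])
    have bd: "bounded (range \<phi>)"
      using Suc.prems(2) by (auto simp: bounded_iff)
    have pos: "0 < (\<integral>v. G p (comp j v) \<partial>emp N (\<omega> p))"
      using N G_pos by (auto simp: integral_emp lessThan_empty_iff intro!: divide_pos_pos sum_pos)
    \<comment> \<open>Unbiasedness of one step: the last factor of \<open>A\<close> cancels the
      normalisation in the conditional mean, which is possible since it is positive.\<close>
    have mean: "A \<omega> * (\<integral>v. \<phi> (comp j v) \<partial>K \<omega>) = gammaN G N p j \<omega> * (\<integral>v. \<psi> (comp j v) \<partial>emp N (\<omega> p))"
      unfolding K_def A_def \<psi>_def
      using pos by (subst integral_Phibar_emp_comp[where G="G p" and r=r, OF N G_pos M j Suc.prems])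
        (use j bd in \<open>auto simp: marginal r_def\<close>)
    have A: "(A \<omega>)\<^sup>2 \<le> (c ^ Suc p)\<^sup>2"
      using gammaN_bounds[OF N, of "Suc p" j \<omega>] unfolding A_def gammaN_def by (intro power_mono) (auto simp: mult.commute)
    have upd: "(\<lambda>x. fun_upd \<omega> (Suc p) x) \<in> PiM {..<N} (\<lambda>_. K \<omega>) \<rightarrow>\<^sub>M path_space N (Suc p)"
      unfolding measurable_cong_sets[OF s refl]
      using \<omega> by (intro measurable_fun_upd[where J="{..p}"]) (auto simp: atMost_Suc)
    have "(\<integral>\<^sup>+\<omega>'. ennreal ((gammaN G N (Suc p) j \<omega>' * (\<integral>v. \<phi> (comp j v) \<partial>emp N (\<omega>' (Suc p))) - \<gamma>)\<^sup>2)
        \<partial>distr (PiM {..<N} (\<lambda>_. K \<omega>)) (path_space N (Suc p)) (\<lambda>x. fun_upd \<omega> (Suc p) x))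
      = (\<integral>\<^sup>+x. ennreal ((A \<omega> * ((\<Sum>i<N. \<phi> (comp j (x i))) / N) - \<gamma>)\<^sup>2) \<partial>PiM {..<N} (\<lambda>_. K \<omega>))"
      by (subst nn_integral_distr[OF upd]) (use F_m in \<open>simp_all add: gammaN_def A_def integral_emp[OF N]\<close>)
    also have "\<dots> \<le> ennreal ((A \<omega>)\<^sup>2 * b\<^sup>2 / N + (A \<omega> * (\<integral>v. \<phi> (comp j v) \<partial>K \<omega>) - \<gamma>)\<^sup>2)"
      by (rule nn_integral_square_iid_mean_le[OF Kp f Suc.prems(2) N])
    also have "\<dots> \<le> ennreal ((c ^ Suc p * b)\<^sup>2 / N + (gammaN G N p j \<omega> * (\<integral>v. \<psi> (comp j v) \<partial>emp N (\<omega> p)) - \<gamma>)\<^sup>2)"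
      unfolding mean power_mult_distrib[of _ b]
      using A by (intro ennreal_leI add_right_mono divide_right_mono mult_right_mono) auto
    finally show ?thesis by simp
  qed
  have m: "(\<lambda>\<omega>. ennreal ((gammaN G N p j \<omega> * (\<integral>v. \<psi> (comp j v) \<partial>emp N (\<omega> p)) - \<gamma>)\<^sup>2))
      \<in> borel_measurable (traj eta0 M G N p)"
    unfolding measurable_cong_sets[OF sets_traj[OF N] refl]
    using measurable_gammaN[OF N, of p p] measurable_emp_integral[OF N, of p p \<psi>] \<psi>_m by measurable
  interpret T: prob_space "traj eta0 M G N p" by (rule prob_space_traj[OF N])
  \<comment> \<open>The conditional bound is integrated over the past: the variance term is constant
    and the squared bias is the induction hypothesis for \<open>\<psi>\<close>.\<close>
  have "(\<integral>\<^sup>+\<omega>. ennreal ((gammaN G N (Suc p) j \<omega> * (\<integral>v. \<phi> (comp j v) \<partial>emp N (\<omega> (Suc p))) - \<gamma>)\<^sup>2)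
      \<partial>traj eta0 M G N (Suc p))
    \<le> (\<integral>\<^sup>+\<omega>. ennreal ((c ^ Suc p * b)\<^sup>2 / N) + ennreal ((gammaN G N p j \<omega> * (\<integral>v. \<psi> (comp j v) \<partial>emp N (\<omega> p)) - \<gamma>)\<^sup>2)
      \<partial>traj eta0 M G N p)"
    unfolding traj.simps K_def[symmetric] nn_integral_bind[OF F_m K_m]
    using step sets_eq_imp_space_eq[OF sets_traj[OF N, of p]] by (intro nn_integral_mono) auto
  also have "\<dots> = ennreal ((c ^ Suc p * b)\<^sup>2 / N) +
      (\<integral>\<^sup>+\<omega>. ennreal ((gammaN G N p j \<omega> * (\<integral>v. \<psi> (comp j v) \<partial>emp N (\<omega> p)) - \<gamma>)\<^sup>2) \<partial>traj eta0 M G N p)"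
    using m by (subst nn_integral_add) (auto simp: T.emeasure_space_1)
  also have "\<dots> \<le> ennreal ((c ^ Suc p * b)\<^sup>2 / N) + ennreal (real (Suc p) * (c ^ p * (c * b))\<^sup>2 / real N)"
    by (intro add_left_mono IH)
  also have "\<dots> = ennreal (real (Suc (Suc p)) * (c ^ Suc p * b)\<^sup>2 / real N)"
    by (subst ennreal_plus[symmetric]) (auto simp: mult_ac add_divide_distrib algebra_simps)
  finally show ?case unfolding \<gamma>_def .
qed

lemma gammaN_mean_square_error:
  assumes N: "N \<ge> 1" and j: "j \<in> {1, 2}"
  shows "(\<integral>\<^sup>+\<omega>. ennreal ((gammaN G N n j \<omega> - gammaFK eta0 Mj G j n (\<lambda>_. 1))\<^sup>2) \<partial>traj eta0 M G N n)
    \<le> ennreal (real (Suc n) * (c ^ n)\<^sup>2 / real N)"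
  using mean_square_error[OF N j, of "\<lambda>_. 1" 1 n] N unfolding integral_emp[OF N] by simp

end

section \<open>Combination of the levels\<close>

theorem mainTheorem1:
  fixes G :: "nat \<Rightarrow> real^'d \<Rightarrow> real"
    and eta0 :: "nat \<Rightarrow> ((real^'d) \<times> (real^'d)) measure"
    and M :: "nat \<Rightarrow> nat \<Rightarrow> (real^'d) \<times> (real^'d) \<Rightarrow> ((real^'d) \<times> (real^'d)) measure"
    and Mj :: "nat \<Rightarrow> nat \<Rightarrow> nat \<Rightarrow> real^'d \<Rightarrow> (real^'d) measure"
    and n L :: nat
  assumes n: "n \<ge> 1" and L: "L \<ge> 1"
    and eta0: "\<And>l. l \<le> L \<Longrightarrow> eta0 l \<in> space (prob_algebra borel)"
    and M_kernel: "\<And>l p. l \<le> L \<Longrightarrow> p \<ge> 1 \<Longrightarrow> M l p \<in> borel \<rightarrow>\<^sub>M prob_algebra borel"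
    and Mj_kernel: "\<And>l p j. l \<le> L \<Longrightarrow> p \<ge> 1 \<Longrightarrow> j \<in> {1, 2} \<Longrightarrow>
                      Mj l p j \<in> borel \<rightarrow>\<^sub>M prob_algebra borel"
    and marginal: "\<And>l p j v (\<phi> :: real^'d \<Rightarrow> real). l \<le> L \<Longrightarrow> p \<ge> 1 \<Longrightarrow> j \<in> {1, 2} \<Longrightarrow>
          \<phi> \<in> borel_measurable borel \<Longrightarrow> bounded (range \<phi>) \<Longrightarrow>
          (\<integral>v'. \<phi> (comp j v') \<partial>(M l p v)) = (\<integral>u'. \<phi> u' \<partial>(Mj l p j (comp j v)))"
    and A1: "\<exists>c C. c > 1 \<and> C > 0 \<and>
          (\<forall>p x x'. 1 / c < G p x \<and> G p x < c \<and> \<bar>G p x - G p x'\<bar> \<le> C * dist x x')"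
    and A2: "\<And>l p. l \<le> L \<Longrightarrow> p \<ge> 1 \<Longrightarrow> \<exists>Cn > 0. \<forall>u u' j (\<phi> :: real^'d \<Rightarrow> real).
          j \<in> {1, 2} \<and> bounded (range \<phi>) \<and> (\<exists>K. K-lipschitz_on UNIV \<phi>) \<longrightarrow>
          \<bar>(\<integral>x. \<phi> x \<partial>(Mj l p j u)) - (\<integral>x. \<phi> x \<partial>(Mj l p j u'))\<bar>
            \<le> Cn * (SUP x. \<bar>\<phi> x\<bar>) * dist u u'"
  shows "\<exists>B :: nat \<Rightarrow> real. \<forall>N :: nat \<Rightarrow> nat. (\<forall>l\<le>L. N l \<ge> 1) \<longrightarrow>
           (\<integral>\<^sup>+\<omega>. ennreal (((\<Sum>l\<le>L. gammaN G (N l) n 1 (\<omega> l)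
                                   - (if l = 0 then 0 else gammaN G (N l) n 2 (\<omega> l)))
                             - (\<Sum>l\<le>L. gammaFK (eta0 l) (Mj l) G 1 n (\<lambda>_. 1)
                                   - (if l = 0 then 0 else gammaFK (eta0 l) (Mj l) G 2 n (\<lambda>_. 1))))\<^sup>2)
             \<partial>(PiM {..L} (\<lambda>l. traj (eta0 l) (M l) G (N l) n)))
           \<le> ennreal (\<Sum>l\<le>L. B l / real (N l))"
proof -
  from A1 obtain c C where c: "c > 1" and G: "\<And>p x. 1 / c < G p x" "\<And>p x. G p x < c"
    and lip: "\<And>p x x'. \<bar>G p x - G p x'\<bar> \<le> C * dist x x'" and C: "C > 0"
    by blast
  \<comment> \<open>Lipschitz continuity provides the Borel measurability of the potentials.\<close>
  have "C-lipschitz_on UNIV (G p)" for p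
    using lip C by (intro lipschitz_onI) (auto simp: dist_real_def)
  then have Gm: "G p \<in> borel_measurable borel" for p
    by (intro borel_measurable_continuous_onI lipschitz_on_continuous_on)
  have Gpos: "0 < G p x" for p x
    using c G(1)[of p x] by (auto intro: less_trans[of 0 "1 / c"])
  have sys: "coupled_system G c (eta0 l) (M l) (Mj l)" if "l \<le> L" for l
    using that Gpos Gm eta0 M_kernel Mj_kernel marginal G(2)[THEN less_imp_le]
    by unfold_locales auto
  define D where "D = real (Suc n) * (c ^ n)\<^sup>2"
  have D: "0 \<le> D" by (simp add: D_def)
  show ?thesis
  \<comment> \<open>The witness stays schematic until the last step fixes it as
    \<open>4 * real (Suc L) * D\<close>; being introduced before \<open>N\<close>, it cannot depend
    on \<open>N\<close>. The factor \<open>Suc L\<close> comes from Cauchy-Schwarz over the levels,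
    one factor 2 from splitting fine and coarse errors, another from bounding both by
    \<open>D / N l\<close>.\<close>
  proof (intro exI allI impI)
    fix N :: "nat \<Rightarrow> nat" assume N: "\<forall>l\<le>L. N l \<ge> 1"
    define T where "T l = traj (eta0 l) (M l) G (N l) n" for l
    define \<gamma> where "\<gamma> j l = gammaFK (eta0 l) (Mj l) G j n (\<lambda>_. 1)" for j l
    define E where "E j l \<omega> = (gammaN G (N l) n j \<omega> - \<gamma> j l)\<^sup>2" for j l \<omega>
    have T: "prob_space (T l)" if "l \<le> L" for l
      unfolding T_def using that N coupled_system.prob_space_traj[OF sys] by blast
    have E_m: "E j l \<in> borel_measurable (T l)" if "l \<le> L" for j l
    proof -
      interpret coupled_system G c "eta0 l" "M l" "Mj l" by (rule sys[OF that])
      have Nl: "N l \<ge> 1" using N that by blast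
      show ?thesis
        unfolding E_def[abs_def] T_def measurable_cong_sets[OF sets_traj[OF Nl] refl]
        using measurable_gammaN[OF Nl, of n n] by measurable
    qed
    have E_le: "(\<integral>\<^sup>+\<omega>. ennreal (E j l (\<omega> l)) \<partial>PiM {..L} T) \<le> ennreal (D / N l)" if l: "l \<le> L" and j: "j \<in> {1, 2}" for j l
    proof -
      \<comment> \<open>The integrand sees only coordinate \<open>l\<close>, so the product law
        projects to the law of that level.\<close>
      have "(\<integral>\<^sup>+\<omega>. ennreal (E j l (\<omega> l)) \<partial>PiM {..L} T) = (\<integral>\<^sup>+\<omega>. ennreal (E j l \<omega>) \<partial>distr (PiM {..L} T) (T l) (\<lambda>\<omega>. \<omega> l))"
        using E_m[OF l] l by (subst nn_integral_distr) auto
      also have "distr (PiM {..L} T) (T l) (\<lambda>\<omega>. \<omega> l) = T l"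
        using T l by (intro distr_PiM_component) auto
      finally show ?thesis
        using coupled_system.gammaN_mean_square_error[OF sys[OF l] _ j, of "N l" n] N l
        by (simp add: E_def T_def[abs_def] \<gamma>_def D_def)
    qed
    have pointwise: "((\<Sum>l\<le>L. gammaN G (N l) n 1 (\<omega> l) - (if l = 0 then 0 else gammaN G (N l) n 2 (\<omega> l)))
        - (\<Sum>l\<le>L. \<gamma> 1 l - (if l = 0 then 0 else \<gamma> 2 l)))\<^sup>2
      \<le> (\<Sum>l\<le>L. real (Suc L) * 2 * (E 1 l (\<omega> l) + E 2 l (\<omega> l)))" (is "?lhs \<omega> \<le> _") for \<omega>
    proof -
      define x where "x l = (gammaN G (N l) n 1 (\<omega> l) - \<gamma> 1 l) -
        (if l = 0 then 0 else gammaN G (N l) n 2 (\<omega> l) - \<gamma> 2 l)" for l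
      have "?lhs \<omega> = (\<Sum>l\<le>L. x l)\<^sup>2"
        unfolding sum_subtractf[symmetric] x_def by (intro arg_cong[where f="\<lambda>t. t\<^sup>2"] sum.cong) auto
      also have "\<dots> \<le> real (Suc L) * (\<Sum>l\<le>L. (x l)\<^sup>2)"
        using sum_squared_le_sum_of_squares[of x "{..L}"] by (simp add: mult.commute)
      also have "\<dots> \<le> real (Suc L) * (\<Sum>l\<le>L. 2 * (E 1 l (\<omega> l) + E 2 l (\<omega> l)))"
      proof (intro mult_left_mono sum_mono)
        fix l
        \<comment> \<open>The gap in the first inequality is the square of \<open>s + t\<close>. The
          second inequality handles level 0, where the coarse error is absent from
          \<open>x l\<close> but kept in the bound for uniformity.\<close>
        have "(s - t)\<^sup>2 \<le> 2 * (s\<^sup>2 + t\<^sup>2)" "s\<^sup>2 \<le> 2 * (s\<^sup>2 + t\<^sup>2)" for s t :: real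
          using zero_le_power2[of "s + t"] by (auto simp: power2_eq_square algebra_simps)
        then show "(x l)\<^sup>2 \<le> 2 * (E 1 l (\<omega> l) + E 2 l (\<omega> l))"
          by (auto simp: x_def E_def)
      qed simp
      finally show ?thesis unfolding sum_distrib_left mult.assoc .
    qed
    have "(\<integral>\<^sup>+\<omega>. ennreal (?lhs \<omega>) \<partial>PiM {..L} T)
      \<le> (\<integral>\<^sup>+\<omega>. (\<Sum>l\<le>L. ennreal (real (Suc L) * 2) * (ennreal (E 1 l (\<omega> l)) + ennreal (E 2 l (\<omega> l)))) \<partial>PiM {..L} T)"
    proof (intro nn_integral_mono)
      fix \<omega>
      have "ennreal (?lhs \<omega>) \<le> ennreal (\<Sum>l\<le>L. real (Suc L) * 2 * (E 1 l (\<omega> l) + E 2 l (\<omega> l)))"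
        by (rule ennreal_leI[OF pointwise])
      also have "\<dots> = (\<Sum>l\<le>L. ennreal (real (Suc L) * 2) * (ennreal (E 1 l (\<omega> l)) + ennreal (E 2 l (\<omega> l))))"
        by (subst sum_ennreal[symmetric])
          (auto simp: E_def ennreal_mult simp flip: ennreal_plus intro!: sum.cong mult_nonneg_nonneg)
      finally show "ennreal (?lhs \<omega>) \<le> \<dots>" .
    qed
    also have "\<dots> = (\<Sum>l\<le>L. ennreal (real (Suc L) * 2) *
        ((\<integral>\<^sup>+\<omega>. ennreal (E 1 l (\<omega> l)) \<partial>PiM {..L} T) + (\<integral>\<^sup>+\<omega>. ennreal (E 2 l (\<omega> l)) \<partial>PiM {..L} T)))"
    proof -
      have [measurable]: "(\<lambda>\<omega>. E j l (\<omega> l)) \<in> borel_measurable (PiM {..L} T)" if "l \<in> {..L}" for j l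
        using that by (intro measurable_compose[OF measurable_component_singleton[of l "{..L}" T] E_m]) auto
      show ?thesis
        by (subst nn_integral_sum, measurable, simp, intro sum.cong refl)
          (simp add: nn_integral_cmult nn_integral_add del: ennreal_plus)
    qed
    also have "\<dots> \<le> (\<Sum>l\<le>L. ennreal (real (Suc L) * 2) * (ennreal (D / N l) + ennreal (D / N l)))"
      by (intro sum_mono mult_left_mono add_mono E_le) auto
    also have "\<dots> = (\<Sum>l\<le>L. ennreal (real (Suc L) * 2 * (D / N l + D / N l)))"
      using D by (intro sum.cong refl) (simp only: ennreal_mult ennreal_plus divide_nonneg_nonneg
          add_nonneg_nonneg mult_nonneg_nonneg of_nat_0_le_iff zero_le_numeral)
    also have "\<dots> = ennreal (\<Sum>l\<le>L. real (Suc L) * 2 * (D / N l + D / N l))"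
      using D by (intro sum_ennreal mult_nonneg_nonneg add_nonneg_nonneg divide_nonneg_nonneg) auto
    also have "(\<Sum>l\<le>L. real (Suc L) * 2 * (D / N l + D / N l)) = (\<Sum>l\<le>L. 4 * real (Suc L) * D / real (N l))"
      by (intro sum.cong) (auto simp: field_simps)
    finally show "(\<integral>\<^sup>+\<omega>. ennreal (((\<Sum>l\<le>L. gammaN G (N l) n 1 (\<omega> l)
                                   - (if l = 0 then 0 else gammaN G (N l) n 2 (\<omega> l)))
                             - (\<Sum>l\<le>L. gammaFK (eta0 l) (Mj l) G 1 n (\<lambda>_. 1)
                                   - (if l = 0 then 0 else gammaFK (eta0 l) (Mj l) G 2 n (\<lambda>_. 1))))\<^sup>2)
             \<partial>(PiM {..L} (\<lambda>l. traj (eta0 l) (M l) G (N l) n)))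
           \<le> ennreal (\<Sum>l\<le>L. 4 * real (Suc L) * D / real (N l))"
      unfolding \<gamma>_def T_def[abs_def] .
  qed
qed

end
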